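(* (Transfinite Induction) Let $S$ be a type and let $\leqslant$ be a well-ordering of $S$. Then for any predicate $P:S\to *_p$ on $S$: $$\bigl(\forall x:S.\,[(\forall y:S.\,(y<x\Rightarrow Py))\Rightarrow Px]\bigr)\Rightarrow \forall x:S.\,Px.$$
   Context: The setting is the dependent type theory $\lambda D$ (Calculus of Constructions with Definitions). $*_s$ is the universe of types regarded as sets and $*_p$ is the universe of propositions. Classical logic is available here: the axiom of excluded third $A\vee\neg A$ for all propositions $A$ is assumed. For a type $S:*_s$, the power set is $ps(S):=S\to *_p$; for $X:ps(S)$ and $x:S$, $x\,\varepsilon\, X$ means $Xx$. A binary relation on $S$ is a term of type $S\to S\to *_p$. Equality $x=y$ of elements of $S$ is Leibniz equality, $\Pi P:S\to *_p.\,(Px\Rightarrow Py)$. A relation $\leqslant$ on $S$ is a partial order if it is reflexive ($\forall x:S.\, x\leqslant x$), antisymmetric ($\forall x,y:S.\,(x\leqslant y\Rightarrow y\leqslant x\Rightarrow x=y)$) and transitive ($\forall x,y,z:S.\,(x\leqslant y\Rightarrow y\leqslant z\Rightarrow x\leqslant z)$). The strict order is $x<y:\Leftrightarrow x\leqslant y\wedge\neg(x=y)$. For $X:ps(S)$ and $x:S$, $x$ is a least element of $X$, written $\mathrm{least}(S,\leqslant,X,x)$, if $x\,\varepsilon\, X\wedge\forall y:S.\,(y\,\varepsilon\, X\Rightarrow x\leqslant y)$. The relation $\leqslant$ is a well-ordering of $S$ if it is a partial order and $\forall X:ps(S).\,[(\exists x:S.\,x\,\varepsilon\, X)\Rightarrow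 \exists x:S.\,\mathrm{least}(S,\leqslant,X,x)]$. *)

theory Defs
  imports Main
begin

definition partial_ord :: "('a \<Rightarrow> 'a \<Rightarrow> bool) \<Rightarrow> bool" where
  "partial_ord le \<longleftrightarrow> reflp le \<and> antisymp le \<and> transp le"

definition strict :: "('a \<Rightarrow> 'a \<Rightarrow> bool) \<Rightarrow> 'a \<Rightarrow> 'a \<Rightarrow> bool" where
  "strict le x y \<longleftrightarrow> le x y \<and> x \<noteq> y"

definition least :: "('a \<Rightarrow> 'a \<Rightarrow> bool) \<Rightarrow> 'a set \<Rightarrow> 'a \<Rightarrow> bool" where
  "least le X x \<longleftrightarrow> x \<in> X \<and> (\<forall>y. y \<in> X \<longrightarrow> le x y)"

(* The library's well_order_on and class wellorder are not used: the first is
   phrased by well-foundedness of the strict part, and the second has the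
   induction principle itself as its axiom. *)
definition well_ordering :: "('a \<Rightarrow> 'a \<Rightarrow> bool) \<Rightarrow> bool" where
  "well_ordering le \<longleftrightarrow>
     partial_ord le \<and> (\<forall>X :: 'a set. (\<exists>x. x \<in> X) \<longrightarrow> (\<exists>x. least le X x))"

end

theory Submission
  imports Defs
begin

text \<open>Minimal counterexample: if \<open>P\<close> failed somewhere, the set of failures would
  have a least element \<open>m\<close>. Everything strictly below \<open>m\<close> then satisfies
  \<open>P\<close>, so the induction step yields \<open>P m\<close>, which is absurd.\<close>

theorem theorem6p5:
  fixes le :: "'a \<Rightarrow> 'a \<Rightarrow> bool" and P :: "'a \<Rightarrow> bool"
  assumes "well_ordering le"
  shows "(\<forall>x. (\<forall>y. strict le y x \<longrightarrow> P y) \<longrightarrow> P x) \<longrightarrow> (\<forall>x. P x)"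
proof (intro impI, rule ccontr)
  assume step: "\<forall>x. (\<forall>y. strict le y x \<longrightarrow> P y) \<longrightarrow> P x"
  assume "\<not> (\<forall>x. P x)"
  then have nonempty: "\<exists>x. x \<in> {x. \<not> P x}" by simp
  have "(\<exists>x. x \<in> {x. \<not> P x}) \<longrightarrow> (\<exists>x. least le {x. \<not> P x} x)"
    using assms unfolding well_ordering_def by (elim conjE allE)
  from this nonempty have "\<exists>x. least le {x. \<not> P x} x" by (rule mp)
  then obtain m where m: "least le {x. \<not> P x} m" ..
  have antisym: "antisymp le"
    using assms by (simp add: well_ordering_def partial_ord_def)
  \<comment> \<open>The order is not assumed linear, so the clash comes from antisymmetry: a failure
    \<open>y\<close> strictly below \<open>m\<close> also lies above \<open>m\<close> by leastness,
    which forces \<open>y = m\<close>.\<close>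
  have "P y" if y: "strict le y m" for y
  proof (rule ccontr)
    assume "\<not> P y"
    with m have "le m y" by (simp add: least_def)
    moreover have "le y m" "y \<noteq> m" using y by (simp_all add: strict_def)
    ultimately show False using antisympD[OF antisym] by simp
  qed
  then have "P m" using step by simp
  with m show False by (simp add: least_def)
qed

end
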